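(* Let $\Gamma=(X,R)$ be a distance-regular graph with diameter $d\ge 3$, intersection number $a_1\ne 0$, and eigenvalues $\theta_0>\theta_1>\cdots>\theta_d$. For every edge $xy\in R$: (i) $xy$ is tight with respect to $\theta_1$ if and only if $$f(x,y)=b_1\,\frac{k+\theta_1(a_1+1)}{(k+\theta_1)(1+\theta_1)};$$ (ii) $xy$ is tight with respect to $\theta_d$ if and only if $$f(x,y)=b_1\,\frac{k+\theta_d(a_1+1)}{(k+\theta_d)(1+\theta_d)};$$ (iii) $xy$ is not tight with respect to $\theta_i$ for $2\le i\le d-1$.
   Context: Graphs are finite, undirected, connected, without loops or multiple edges. For a graph $\Gamma=(X,R)$ with vertex set $X$, edge set $R$, path-length distance $\partial$ and diameter $d=\max\{\partial(x,y): x,y\in X\}$, put $\Gamma_i(x)=\{y\in X:\partial(x,y)=i\}$. $\Gamma$ is distance-regular if for all $0\le h,i,j\le d$ and all $x,y\in X$ with $\partial(x,y)=h$ the number $p^h_{ij}=|\Gamma_i(x)\cap\Gamma_j(y)|$ does not depend on $x,y$. Then $c_i=p^i_{1,i-1}$ $(1\le i\le d)$, $a_i=p^i_{1i}$ $(0\le i\le d)$, $b_i=p^i_{1,i+1}$ $(0\le i\le d-1)$, $c_0=0$, $b_d=0$, and $k=b_0$ is the valency. The eigenvalues of $\Gamma$ are the distinct eigenvalues of its adjacency matrix; there are exactly $d+1$ of them, all real, $\theta_0>\theta_1>\cdots>\theta_d$, with $\theta_0=k$ the trivial eigenvalue. For an edge $xy$ let $D_1^1=\Gamma_1(x)\cap\Gamma_1(y)$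 (a set of size $a_1$) and, when $a_1\neq0$, let $f(x,y)=a_1^{-1}\,|\{(z,w)\in X^2: z,w\in D_1^1,\ \partial(z,w)=2\}|$. The primitive idempotent $E$ of an eigenvalue $\theta$ is the matrix of the orthogonal projection of $\mathbb{R}^X$ onto the $\theta$-eigenspace of the adjacency matrix; $\hat z\in\mathbb{R}^X$ denotes the vector with $1$ in coordinate $z$ and $0$ elsewhere. For $a_1\ne0$ and $\theta\neq k$ an eigenvalue with primitive idempotent $E$, the edge $xy$ is tight with respect to $\theta$ if the three vectors $E\hat x$, $E\hat y$, $\sum_{z\in D_1^1}E\hat z$ are linearly dependent. *)

theory Defs
  imports "HOL-Analysis.Analysis"
begin

section \<open>Finite connected simple graphs\<close>

text \<open>The vertex set is a finite type \<open>'a\<close>, so that \<open>real ^ 'a\<close> is the space of real vectors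
  indexed by the vertices. The edge set is a relation containing both orientations of every edge.\<close>

definition connected_simple_graph :: "('a::finite \<times> 'a) set \<Rightarrow> bool" where
  "connected_simple_graph R \<longleftrightarrow> sym R \<and> irrefl R \<and> R\<^sup>* = UNIV"

text \<open>\<open>(x, y) \<in> R ^^ n\<close> says that there is a walk of length \<open>n\<close> from \<open>x\<close> to \<open>y\<close>. The value is
  meaningful only if some walk exists, which is the case in a connected graph.\<close>

definition gdist :: "('a \<times> 'a) set \<Rightarrow> 'a \<Rightarrow> 'a \<Rightarrow> nat" where
  "gdist R x y = (LEAST n. (x, y) \<in> R ^^ n)"

definition diam :: "('a::finite \<times> 'a) set \<Rightarrow> nat" where
  "diam R = Max {gdist R x y | x y. True}"

definition Gamma :: "('a \<times> 'a) set \<Rightarrow> nat \<Rightarrow> 'a \<Rightarrow> 'a set" where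
  "Gamma R i x = {y. gdist R x y = i}"


section \<open>Distance-regular graphs\<close>

definition distance_regular :: "('a::finite \<times> 'a) set \<Rightarrow> bool" where
  "distance_regular R \<longleftrightarrow> connected_simple_graph R \<and>
     (\<forall>h i j x y x' y'. h \<le> diam R \<longrightarrow> i \<le> diam R \<longrightarrow> j \<le> diam R \<longrightarrow>
        gdist R x y = h \<longrightarrow> gdist R x' y' = h \<longrightarrow>
        card (Gamma R i x \<inter> Gamma R j y) = card (Gamma R i x' \<inter> Gamma R j y'))"

text \<open>The number \<open>p\<^sup>h\<^sub>i\<^sub>j\<close>; well defined for \<open>h, i, j \<le> diam R\<close> in a distance-regular graph, by
  \<open>intersection_number_eq\<close> below and because every \<open>h \<le> diam R\<close> occurs as a distance.\<close>

definition intersection_number :: "('a::finite \<times> 'a) set \<Rightarrow> nat \<Rightarrow> nat \<Rightarrow> nat \<Rightarrow> nat" where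
  "intersection_number R h i j =
     (THE n. \<forall>x y. gdist R x y = h \<longrightarrow> card (Gamma R i x \<inter> Gamma R j y) = n)"

lemma gdist_le_diam: "gdist R x y \<le> diam R"
proof -
  have "{gdist R x y | x y. True} = (\<lambda>(x, y). gdist R x y) ` UNIV"
    by auto
  then have "finite {gdist R x y | x y. True}"
    by simp
  then show ?thesis
    unfolding diam_def by (intro Max_ge) auto
qed

lemma intersection_number_eq:
  assumes "distance_regular R" "i \<le> diam R" "j \<le> diam R"
  shows "intersection_number R (gdist R x y) i j = card (Gamma R i x \<inter> Gamma R j y)"
  unfolding intersection_number_def
proof (rule the_equality)
  show "\<forall>x' y'. gdist R x' y' = gdist R x y \<longrightarrow>
      card (Gamma R i x' \<inter> Gamma R j y') = card (Gamma R i x \<inter> Gamma R j y)"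
    using assms gdist_le_diam unfolding distance_regular_def by metis
qed blast

definition int_a :: "('a::finite \<times> 'a) set \<Rightarrow> nat \<Rightarrow> nat" where
  "int_a R i = intersection_number R i 1 i"

definition int_b :: "('a::finite \<times> 'a) set \<Rightarrow> nat \<Rightarrow> nat" where
  "int_b R i = intersection_number R i 1 (i + 1)"

definition valency :: "('a::finite \<times> 'a) set \<Rightarrow> nat" where
  "valency R = int_b R 0"


section \<open>Eigenvalues and primitive idempotents\<close>

definition adjacency_matrix :: "('a::finite \<times> 'a) set \<Rightarrow> real ^ 'a ^ 'a" where
  "adjacency_matrix R = (\<chi> x y. if (x, y) \<in> R then 1 else 0)"

definition eigenspace :: "real ^ 'a ^ 'a \<Rightarrow> real \<Rightarrow> (real ^ 'a::finite) set" where
  "eigenspace A \<theta> = {v. A *v v = \<theta> *\<^sub>R v}"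

text \<open>Real eigenvalues suffice, since the adjacency matrix is symmetric.\<close>

definition eigenvalues :: "('a::finite \<times> 'a) set \<Rightarrow> real set" where
  "eigenvalues R = {\<theta>. \<exists>v. v \<noteq> 0 \<and> adjacency_matrix R *v v = \<theta> *\<^sub>R v}"

definition is_orthogonal_projection :: "real ^ 'a ^ 'a \<Rightarrow> (real ^ 'a::finite) set \<Rightarrow> bool" where
  "is_orthogonal_projection E S \<longleftrightarrow>
     (\<forall>v. E *v v \<in> S \<and> (\<forall>w \<in> S. orthogonal (v - E *v v) w))"

definition primitive_idempotent :: "('a::finite \<times> 'a) set \<Rightarrow> real \<Rightarrow> real ^ 'a ^ 'a" where
  "primitive_idempotent R \<theta> =
     (THE E. is_orthogonal_projection E (eigenspace (adjacency_matrix R) \<theta>))"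

lemma subspace_eigenspace: "subspace (eigenspace A \<theta>)"
  by (auto simp: subspace_def eigenspace_def matrix_vector_right_distrib scaleR_right_distrib
      matrix_vector_mult_scaleR)

lemma orthogonal_projection_ex1:
  fixes S :: "(real ^ 'a::finite) set"
  assumes S: "subspace S"
  shows "\<exists>!E. is_orthogonal_projection E S"
proof -
  have uniq: "p = q"
    if "p \<in> S" "q \<in> S" "\<forall>w\<in>S. orthogonal (v - p) w" "\<forall>w\<in>S. orthogonal (v - q) w" for p q v
  proof -
    have "p - q \<in> S" using that S by (simp add: subspace_diff)
    then have "(v - q) \<bullet> (p - q) = 0" "(v - p) \<bullet> (p - q) = 0"
      using that by (auto simp: orthogonal_def)
    then have "(p - q) \<bullet> (p - q) = 0" by (simp add: inner_diff_left)
    then show ?thesis by simp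
  qed
  have "\<exists>p. p \<in> S \<and> (\<forall>w\<in>S. orthogonal (v - p) w)" for v
  proof -
    obtain y z where "y \<in> span S" "\<And>w. w \<in> span S \<Longrightarrow> orthogonal z w" "v = y + z"
      using orthogonal_subspace_decomp_exists[of S v] by blast
    moreover have "span S = S" using S by simp
    ultimately show ?thesis by (intro exI[of _ y]) simp
  qed
  then obtain p where p: "\<And>v. p v \<in> S" "\<And>v. \<forall>w\<in>S. orthogonal (v - p v) w"
    by metis
  have "linear p"
  proof (rule linearI)
    fix u v :: "real ^ 'a" and c :: real
    show "p (u + v) = p u + p v"
    proof (rule uniq[of _ _ "u + v"])
      have "(u - p u) + (v - p v) = u + v - (p u + p v)" by simp
      then show "\<forall>w\<in>S. orthogonal (u + v - (p u + p v)) w"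
        using p(2)[of u] p(2)[of v] by (simp add: orthogonal_def inner_diff_left inner_add_left)
    qed (use p S in \<open>auto simp: subspace_add\<close>)
    show "p (c *\<^sub>R u) = c *\<^sub>R p u"
    proof (rule uniq[of _ _ "c *\<^sub>R u"])
      show "\<forall>w\<in>S. orthogonal (c *\<^sub>R u - c *\<^sub>R p u) w"
        using p(2)[of u] by (simp add: orthogonal_def flip: scaleR_diff_right)
    qed (use p S in \<open>auto simp: subspace_scale\<close>)
  qed
  then have m: "matrix p *v v = p v" for v
    by (simp add: matrix_works)
  show ?thesis
  proof (rule ex1I[of _ "matrix p"])
    show "is_orthogonal_projection (matrix p) S"
      using p m by (simp add: is_orthogonal_projection_def)
    fix E assume E: "is_orthogonal_projection E S"
    have "E *v v = matrix p *v v" for v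
      using E p unfolding is_orthogonal_projection_def m by (intro uniq[of _ _ v]) auto
    then show "E = matrix p" by (simp add: matrix_eq)
  qed
qed

lemma is_orthogonal_projection_primitive_idempotent:
  "is_orthogonal_projection (primitive_idempotent R \<theta>) (eigenspace (adjacency_matrix R) \<theta>)"
  unfolding primitive_idempotent_def
  by (rule theI'[OF orthogonal_projection_ex1[OF subspace_eigenspace]])


section \<open>Tight edges\<close>

definition common_neighbours :: "('a \<times> 'a) set \<Rightarrow> 'a \<Rightarrow> 'a \<Rightarrow> 'a set" where
  "common_neighbours R x y = Gamma R 1 x \<inter> Gamma R 1 y"

text \<open>The pairs counted here are ordered. Intended for an edge \<open>(x, y)\<close> and \<open>int_a R 1 \<noteq> 0\<close>.\<close>

definition edge_f :: "('a::finite \<times> 'a) set \<Rightarrow> 'a \<Rightarrow> 'a \<Rightarrow> real" where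
  "edge_f R x y =
     inverse (real (int_a R 1)) *
     real (card {(z, w). z \<in> common_neighbours R x y \<and> w \<in> common_neighbours R x y \<and>
                         gdist R z w = 2})"

text \<open>Linear dependence of the family of three vectors, which (unlike dependence of the set they
  form) also holds when two of them coincide. \<open>axis z 1\<close> is the unit vector of the vertex \<open>z\<close>.
  Intended for an edge \<open>(x, y)\<close>, \<open>int_a R 1 \<noteq> 0\<close> and an eigenvalue \<open>\<theta> \<noteq> valency R\<close>.\<close>

definition tight_edge :: "('a::finite \<times> 'a) set \<Rightarrow> real \<Rightarrow> 'a \<Rightarrow> 'a \<Rightarrow> bool" where
  "tight_edge R \<theta> x y \<longleftrightarrow>
     (let E = primitive_idempotent R \<theta> in
      \<exists>\<alpha> \<beta> \<gamma>. (\<alpha>, \<beta>, \<gamma>) \<noteq> (0, 0, 0) \<and>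
        \<alpha> *\<^sub>R (E *v axis x 1) + \<beta> *\<^sub>R (E *v axis y 1) +
        \<gamma> *\<^sub>R (\<Sum>z \<in> common_neighbours R x y. E *v axis z 1) = 0)"

end

theory Submission
  imports Defs
begin

text \<open>
  Fix an edge \<open>xy\<close> and a nontrivial eigenvalue \<open>\<theta>\<close> with primitive idempotent \<open>E\<close>. The entry of
  \<open>E\<close> at two vertices depends only on their distance
  (\<open>bose_mesner_primitive_idempotent\<close>), so the inner products of \<open>E x\<close>, \<open>E y\<close> and
  \<open>\<Sum>z. E z\<close> (\<open>z\<close> running over the common neighbours) are determined by \<open>\<theta>\<close>, by the intersection
  numbers and by \<open>f = edge_f R x y\<close>, which is \<open>1/a\<^sub>1\<close> times the number of pairs of common neighbours at
  distance 2. The Gram determinant of the three vectors is nonnegative and vanishes exactly when they are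
  dependent. The equation \<open>A E = \<theta> E\<close> expresses all entries involved through \<open>\<theta>\<close>, and the
  determinant becomes a positive multiple of
  \<open>b\<^sub>1 (k + \<theta> (a\<^sub>1 + 1)) - (k + \<theta>) (1 + \<theta>) f\<close>.
  So this quantity is nonnegative for every nontrivial eigenvalue, and it is zero iff the edge is
  tight (\<open>tight_edge_bound\<close>). Since \<open>a\<^sub>1 \<noteq> 0\<close>, moreover \<open>\<theta> > -k\<close>.

  With \<open>F t = (k + t (a\<^sub>1 + 1)) / ((k + t) (1 + t))\<close>, this bounds \<open>f\<close> from above by \<open>b\<^sub>1 F \<theta>\<close>
  if \<open>\<theta> > -1\<close> and from below if \<open>\<theta> < -1\<close>, with equality iff the edge is tight. Testing the
  quadratic form of the adjacency matrix on a difference of two nonadjacent vertices and on an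
  alternating path of length 2 shows \<open>\<theta>\<^sub>1 > -1\<close> and \<open>\<theta>\<^sub>d < -1\<close>, which gives the two
  characterisations.

  For an eigenvalue strictly between \<open>\<theta>\<^sub>d\<close> and \<open>\<theta>\<^sub>1\<close>, tightness would contradict one of the two
  extreme bounds: \<open>F\<close> is strictly decreasing on \<open>(-k, -1)\<close> and on \<open>(-1, \<infinity>)\<close>
  (\<open>tightness_ratio_strict_antimono\<close>), so the bound at \<open>\<theta>\<^sub>1\<close> or at \<open>\<theta>\<^sub>d\<close> is strictly stronger than
  the one at the intermediate eigenvalue. For the eigenvalue \<open>-1\<close> the quantity above is \<open>b\<^sub>1\<^sup>2 > 0\<close>.
\<close>


section \<open>Path-length distance\<close>

lemma gdist_le_walk: "(x, y) \<in> R ^^ n \<Longrightarrow> gdist R x y \<le> n"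
  unfolding gdist_def by (rule Least_le)

context
  fixes R :: "('a::finite \<times> 'a) set"
  assumes conn: "connected_simple_graph R"
begin

lemma edge_sym: "(x, y) \<in> R \<longleftrightarrow> (y, x) \<in> R"
  using conn by (auto simp: connected_simple_graph_def sym_def)

lemma no_loop: "(x, x) \<notin> R"
  using conn by (auto simp: connected_simple_graph_def irrefl_def)

lemma gdist_walk: "(x, y) \<in> R ^^ gdist R x y"
proof -
  have "(x, y) \<in> R\<^sup>*"
    using conn by (simp add: connected_simple_graph_def)
  then obtain n where "(x, y) \<in> R ^^ n"
    using rtrancl_imp_relpow by blast
  then show ?thesis
    unfolding gdist_def by (rule LeastI)
qed

lemma gdist_eq_0_iff: "gdist R x y = 0 \<longleftrightarrow> x = y"
  using gdist_walk[of x y] gdist_le_walk[of x y 0 R] by auto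

lemma gdist_eq_1_iff: "gdist R x y = 1 \<longleftrightarrow> (x, y) \<in> R"
proof
  assume "gdist R x y = 1"
  then show "(x, y) \<in> R"
    using gdist_walk[of x y] by simp
next
  assume "(x, y) \<in> R"
  then have "gdist R x y \<le> 1" "x \<noteq> y"
    using gdist_le_walk[of x y 1 R] no_loop by auto
  then show "gdist R x y = 1"
    using gdist_eq_0_iff[of x y] by linarith
qed

lemma walk_sym: "(x, y) \<in> R ^^ n \<Longrightarrow> (y, x) \<in> R ^^ n"
proof (induction n arbitrary: y)
  case (Suc n)
  then obtain z where "(x, z) \<in> R ^^ n" "(z, y) \<in> R"
    by auto
  then show ?case
    using Suc.IH edge_sym relpow_Suc_I2 by metis
qed simp

lemma gdist_sym: "gdist R x y = gdist R y x"
  using walk_sym gdist_walk gdist_le_walk by (metis order_antisym)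

lemma gdist_triangle: "gdist R x z \<le> gdist R x y + gdist R y z"
  by (rule gdist_le_walk, rule relpow_trans[OF gdist_walk gdist_walk])

lemma geodesic_first_step:
  assumes "gdist R x y = Suc n"
  obtains z where "(x, z) \<in> R" "gdist R z y = n"
proof -
  have "(x, y) \<in> R ^^ Suc n"
    using gdist_walk[of x y] assms by simp
  then obtain z where z: "(x, z) \<in> R" "(z, y) \<in> R ^^ n"
    using relpow_Suc_E2 by metis
  have "gdist R z y \<le> n"
    using z by (simp add: gdist_le_walk)
  moreover have "Suc n \<le> 1 + gdist R z y"
    using gdist_triangle[of x y z] assms z(1) gdist_eq_1_iff by metis
  ultimately show ?thesis
    using z(1) by (intro that) auto
qed

lemma ex_gdist_2:
  assumes "2 \<le> diam R"
  obtains x y z where "(x, y) \<in> R" "(y, z) \<in> R" "gdist R x z = 2"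
proof -
  have eq: "{gdist R x y | x y. True} = range (\<lambda>(x, y). gdist R x y)"
    by auto
  have "diam R \<in> range (\<lambda>(x, y). gdist R x y)"
    unfolding diam_def eq by (rule Max_in) simp_all
  then obtain x y where "gdist R x y = diam R"
    by auto
  then have "gdist R x y = 2 + (diam R - 2)"
    using assms by simp
  moreover have "\<exists>x z. gdist R x z = 2" if "gdist R x y = 2 + m" for x m
    using that
  proof (induction m arbitrary: x)
    case (Suc m)
    then show ?case
      using geodesic_first_step[of x y "2 + m"] by (metis add_Suc_right)
  qed auto
  ultimately obtain x z where xz: "gdist R x z = 2"
    by blast
  then obtain y where "(x, y) \<in> R" "gdist R y z = 1"
    using geodesic_first_step[of x z 1] by auto
  then show ?thesis
    using xz gdist_eq_1_iff that by metis
qed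

lemma Gamma_1_eq: "Gamma R 1 x = {z. (x, z) \<in> R}"
  unfolding Gamma_def using gdist_eq_1_iff by auto

section \<open>The adjacency operator\<close>

lemma adjacency_apply: "(adjacency_matrix R *v v) $ x = (\<Sum>z\<in>Gamma R 1 x. v $ z)"
proof -
  have "(adjacency_matrix R *v v) $ x = (\<Sum>z\<in>UNIV. if (x, z) \<in> R then v $ z else 0)"
    unfolding matrix_vector_mult_def adjacency_matrix_def
    by (auto intro!: sum.cong)
  also have "\<dots> = (\<Sum>z\<in>Gamma R 1 x. v $ z)"
    unfolding Gamma_1_eq by (simp add: sum.If_cases)
  finally show ?thesis .
qed

lemma transpose_adjacency: "transpose (adjacency_matrix R) = adjacency_matrix R"
  by (simp add: transpose_def adjacency_matrix_def vec_eq_iff edge_sym)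

lemma adjacency_selfadjoint:
  "(adjacency_matrix R *v u) \<bullet> v = u \<bullet> (adjacency_matrix R *v v)"
  by (metis dot_lmul_matrix transpose_adjacency transpose_matrix_vector)

end

text \<open>With respect to the trace form, which is the Euclidean inner product of matrices, left
  multiplication by a symmetric matrix is a self-adjoint operator.\<close>

lemma inner_matrix_mult_symmetric:
  fixes A M N :: "real ^ 'n ^ 'n"
  assumes "transpose A = A"
  shows "(A ** M) \<bullet> N = M \<bullet> (A ** N)"
proof -
  have A: "A $ i $ j = A $ j $ i" for i j
    using assms by (metis transpose_def vec_lambda_beta)
  have "(A ** M) \<bullet> N = (\<Sum>i\<in>UNIV. \<Sum>j\<in>UNIV. \<Sum>k\<in>UNIV. A $ i $ k * M $ k $ j * N $ i $ j)"
    by (simp add: inner_vec_def matrix_matrix_mult_def sum_distrib_right)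
  also have "\<dots> = (\<Sum>i\<in>UNIV. \<Sum>k\<in>UNIV. \<Sum>j\<in>UNIV. A $ i $ k * M $ k $ j * N $ i $ j)"
    by (intro sum.cong refl sum.swap)
  also have "\<dots> = (\<Sum>k\<in>UNIV. \<Sum>i\<in>UNIV. \<Sum>j\<in>UNIV. A $ i $ k * M $ k $ j * N $ i $ j)"
    by (rule sum.swap)
  also have "\<dots> = (\<Sum>k\<in>UNIV. \<Sum>j\<in>UNIV. \<Sum>i\<in>UNIV. A $ i $ k * M $ k $ j * N $ i $ j)"
    by (intro sum.cong refl sum.swap)
  also have "\<dots> = (\<Sum>k\<in>UNIV. \<Sum>j\<in>UNIV. \<Sum>i\<in>UNIV. M $ k $ j * (A $ k $ i * N $ i $ j))"
    by (intro sum.cong refl) (metis A mult.assoc mult.commute)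
  also have "\<dots> = M \<bullet> (A ** N)"
    by (simp add: inner_vec_def matrix_matrix_mult_def sum_distrib_left)
  finally show ?thesis .
qed

text \<open>A maximiser of the Rayleigh quotient on the unit sphere of an invariant subspace is an
  eigenvector. This yields an eigenvalue that is bounded below by the Rayleigh quotient of any test
  vector in the subspace.\<close>

lemma selfadjoint_max_eigenvector:
  fixes f :: "'b::euclidean_space \<Rightarrow> 'b"
  assumes f: "linear f" and S: "subspace S" "S \<noteq> {0}"
    and inv: "\<And>u. u \<in> S \<Longrightarrow> f u \<in> S"
    and sa: "\<And>u v. f u \<bullet> v = u \<bullet> f v"
  obtains v m where "v \<in> S" "v \<noteq> 0" "f v = m *\<^sub>R v" "\<forall>u\<in>S. u \<bullet> f u \<le> m * (u \<bullet> u)"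
proof -
  interpret f: linear f by (rule f)
  have normed: "u /\<^sub>R norm u \<in> S \<inter> sphere 0 1" if "u \<in> S" "u \<noteq> 0" for u
    using that S(1) by (auto simp: subspace_scale)
  have "S \<inter> sphere 0 1 \<noteq> {}"
    using S normed subspace_0 by blast
  moreover have "compact (S \<inter> sphere 0 1)"
    using S(1) by (intro closed_Int_compact closed_subspace compact_sphere)
  moreover have "continuous_on (S \<inter> sphere 0 1) (\<lambda>u. u \<bullet> f u)"
    by (intro continuous_intros linear_continuous_on linear_conv_bounded_linear[THEN iffD1] f)
  ultimately obtain v where v: "v \<in> S" "norm v = 1"
    and vmax: "\<And>u. u \<in> S \<inter> sphere 0 1 \<Longrightarrow> u \<bullet> f u \<le> v \<bullet> f v"
    using continuous_attains_sup[of "S \<inter> sphere 0 1" "\<lambda>u. u \<bullet> f u"]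
    by (metis Int_iff mem_sphere_0)
  define m where "m = v \<bullet> f v"
  have le: "u \<bullet> f u \<le> m * (u \<bullet> u)" if "u \<in> S" for u
  proof (cases "u = 0")
    case False
    then have "(u /\<^sub>R norm u) \<bullet> f (u /\<^sub>R norm u) \<le> m"
      using vmax normed that unfolding m_def by blast
    then have "(u \<bullet> f u) / (norm u)\<^sup>2 \<le> m"
      by (simp add: f.scaleR power2_eq_square divide_inverse mult_ac)
    then show ?thesis
      using False by (simp add: divide_le_eq power2_norm_eq_inner)
  qed (simp add: f.zero)
  define w where "w = m *\<^sub>R v - f v"
  have wS: "w \<in> S"
    unfolding w_def using S(1) v inv by (simp add: subspace_diff subspace_scale)
  define c where "c = m * (w \<bullet> w) - w \<bullet> f w"
  have c: "c \<ge> 0"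
    using le[OF wS] by (simp add: c_def)
  \<comment> \<open>The minimiser over \<open>t\<close> of \<open>c t\<^sup>2 + 2 t (w \<bullet> w)\<close>, with \<open>c + 1\<close> instead of \<open>c\<close> to
    avoid a zero denominator.\<close>
  define t where "t = - (w \<bullet> w) / (c + 1)"
  have vv: "v \<bullet> v = 1"
    using v by (simp add: norm_eq_1)
  have vfw: "v \<bullet> f w = w \<bullet> f v"
    using sa by (metis inner_commute)
  have "m * (v \<bullet> w) - w \<bullet> f v = (m *\<^sub>R v - f v) \<bullet> w"
    by (simp add: inner_diff_left inner_diff_right inner_commute)
  then have wfv: "w \<bullet> f v = m * (v \<bullet> w) - w \<bullet> w"
    unfolding w_def[symmetric] by simp
  have num: "(v + t *\<^sub>R w) \<bullet> f (v + t *\<^sub>R w) =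
      m + 2 * t * (m * (v \<bullet> w) - w \<bullet> w) + t * t * (w \<bullet> f w)"
    unfolding wfv[symmetric]
    by (simp add: f.add f.scaleR inner_add_left inner_add_right vfw m_def algebra_simps)
  have den: "(v + t *\<^sub>R w) \<bullet> (v + t *\<^sub>R w) = 1 + 2 * t * (v \<bullet> w) + t * t * (w \<bullet> w)"
    by (simp add: inner_add_left inner_add_right vv inner_commute[of w v] algebra_simps)
  \<comment> \<open>A step from the maximiser along the residual cannot increase the Rayleigh quotient,
    yet to first order in the step length it would unless the residual vanishes.\<close>
  have "(v + t *\<^sub>R w) \<bullet> f (v + t *\<^sub>R w) \<le> m * ((v + t *\<^sub>R w) \<bullet> (v + t *\<^sub>R w))"
    using S(1) v wS by (intro le) (simp add: subspace_add subspace_scale)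
  then have "0 \<le> t * t * c + 2 * t * (w \<bullet> w)"
    unfolding num den c_def by (simp add: algebra_simps)
  moreover have ww: "w \<bullet> w = - t * (c + 1)"
    using c by (simp add: t_def)
  ultimately have "t * t * (c + 2) \<le> 0"
    by (simp add: algebra_simps)
  then have "t = 0"
    using c by (auto simp: mult_le_0_iff)
  then have "w = 0"
    using ww by simp
  then have "f v = m *\<^sub>R v"
    by (simp add: w_def)
  then show ?thesis
    using v le by (intro that[of v m]) auto
qed


section \<open>Primitive idempotents of a distance-regular graph\<close>

lemma primitive_idempotent_mem: "primitive_idempotent R \<theta> *v v \<in> eigenspace (adjacency_matrix R) \<theta>"
  using is_orthogonal_projection_primitive_idempotent[of R \<theta>]
  by (simp add: is_orthogonal_projection_def)

lemma primitive_idempotent_orthogonal: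
  assumes "w \<in> eigenspace (adjacency_matrix R) \<theta>"
  shows "(v - primitive_idempotent R \<theta> *v v) \<bullet> w = 0"
  using is_orthogonal_projection_primitive_idempotent[of R \<theta>] assms
  by (simp add: is_orthogonal_projection_def orthogonal_def)

lemma primitive_idempotent_fixes:
  assumes "w \<in> eigenspace (adjacency_matrix R) \<theta>"
  shows "primitive_idempotent R \<theta> *v w = w"
proof -
  let ?r = "w - primitive_idempotent R \<theta> *v w"
  have "?r \<in> eigenspace (adjacency_matrix R) \<theta>"
    using assms primitive_idempotent_mem by (intro subspace_diff subspace_eigenspace)
  then have "?r \<bullet> ?r = 0"
    by (rule primitive_idempotent_orthogonal)
  then show ?thesis
    by simp
qed

text \<open>A projection is symmetric and idempotent, so its entries are the inner products of the
  projected unit vectors.\<close>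

lemma inner_primitive_idempotent_axis:
  "(primitive_idempotent R \<theta> *v axis u 1) \<bullet> (primitive_idempotent R \<theta> *v axis v 1) =
    primitive_idempotent R \<theta> $ u $ v"
proof -
  have "(axis u 1 - primitive_idempotent R \<theta> *v axis u 1) \<bullet> (primitive_idempotent R \<theta> *v axis v 1) = 0"
    by (intro primitive_idempotent_orthogonal primitive_idempotent_mem)
  then show ?thesis
    by (simp add: inner_diff_left inner_axis' matrix_vector_mult_basis column_def)
qed

text \<open>For a distance-regular graph these matrices form the Bose-Mesner algebra, the span of the
  distance matrices \<open>A\<^sub>0, A\<^sub>1, \<dots>\<close> (\<open>A\<^sub>i\<close> being the 0-1 matrix of the relation \<open>gdist R u v = i\<close>).\<close>

definition bose_mesner :: "('a \<times> 'a) set \<Rightarrow> real ^ 'a ^ 'a \<Rightarrow> bool" where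
  "bose_mesner R N \<longleftrightarrow> (\<exists>n. \<forall>u v. N $ u $ v = n (gdist R u v))"

lemma subspace_bose_mesner: "subspace {N. bose_mesner R N}"
proof (rule subspaceI)
  show "0 \<in> {N. bose_mesner R N}"
    unfolding bose_mesner_def by (auto intro: exI[of _ "\<lambda>_. 0"])
next
  fix M N assume "M \<in> {N. bose_mesner R N}" "N \<in> {N. bose_mesner R N}"
  then obtain m n where "\<And>u v. M $ u $ v = m (gdist R u v)" "\<And>u v. N $ u $ v = n (gdist R u v)"
    unfolding bose_mesner_def by auto
  then show "M + N \<in> {N. bose_mesner R N}"
    unfolding bose_mesner_def by (auto intro: exI[of _ "\<lambda>i. m i + n i"])
next
  fix c M assume "M \<in> {N. bose_mesner R N}"
  then obtain m where "\<And>u v. M $ u $ v = m (gdist R u v)"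
    unfolding bose_mesner_def by auto
  then show "c *\<^sub>R M \<in> {N. bose_mesner R N}"
    unfolding bose_mesner_def by (auto intro: exI[of _ "\<lambda>i. c * m i"])
qed

context
  fixes R :: "('a::finite \<times> 'a) set"
  assumes dr: "distance_regular R"
begin

lemma distance_regular_connected: "connected_simple_graph R"
  using dr by (simp add: distance_regular_def)

text \<open>The entry of \<open>A N\<close> at \<open>(u, v)\<close> sums \<open>N\<close> over the neighbours \<open>z\<close> of \<open>u\<close>. Grouping these by
  their distance to \<open>v\<close> gives groups whose sizes are intersection numbers.\<close>

lemma bose_mesner_adjacency_mult:
  assumes "bose_mesner R N"
  shows "bose_mesner R (adjacency_matrix R ** N)"
proof (cases "1 \<le> diam R")
  case True
  obtain n where n: "\<And>u v. N $ u $ v = n (gdist R u v)"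
    using assms unfolding bose_mesner_def by blast
  have "(adjacency_matrix R ** N) $ u $ v =
      (\<Sum>j\<le>diam R. real (intersection_number R (gdist R u v) 1 j) * n j)" for u v
  proof -
    have "(adjacency_matrix R ** N) $ u $ v = (adjacency_matrix R *v column v N) $ u"
      by (simp add: matrix_matrix_mult_def matrix_vector_mult_def column_def)
    also have "\<dots> = (\<Sum>z\<in>Gamma R 1 u. n (gdist R z v))"
      by (simp add: adjacency_apply[OF distance_regular_connected] column_def n)
    also have "\<dots> = (\<Sum>j\<le>diam R. \<Sum>z\<in>{z \<in> Gamma R 1 u. gdist R z v = j}. n (gdist R z v))"
      by (rule sum.group[symmetric]) (auto simp: gdist_le_diam)
    also have "\<dots> = (\<Sum>j\<le>diam R. real (card (Gamma R 1 u \<inter> Gamma R j v)) * n j)"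
    proof (intro sum.cong refl)
      fix j
      have "{z \<in> Gamma R 1 u. gdist R z v = j} = Gamma R 1 u \<inter> Gamma R j v"
        by (auto simp: Gamma_def gdist_sym[OF distance_regular_connected])
      moreover have "(\<Sum>z\<in>{z \<in> Gamma R 1 u. gdist R z v = j}. n (gdist R z v)) =
          (\<Sum>z\<in>{z \<in> Gamma R 1 u. gdist R z v = j}. n j)"
        by (rule sum.cong) auto
      ultimately show "(\<Sum>z\<in>{z \<in> Gamma R 1 u. gdist R z v = j}. n (gdist R z v)) =
          real (card (Gamma R 1 u \<inter> Gamma R j v)) * n j"
        by simp
    qed
    also have "\<dots> = (\<Sum>j\<le>diam R. real (intersection_number R (gdist R u v) 1 j) * n j)"
      using True by (intro sum.cong refl) (simp add: intersection_number_eq[OF dr])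
    finally show ?thesis .
  qed
  then show ?thesis
    unfolding bose_mesner_def
    by (intro exI[of _ "\<lambda>i. \<Sum>j\<le>diam R. real (intersection_number R i 1 j) * n j"]) blast
next
  case False
  \<comment> \<open>With diameter 0 there is a single vertex, and every matrix is constant.\<close>
  then have "u = v" for u v :: 'a
    using gdist_le_diam[of R u v] gdist_eq_0_iff[OF distance_regular_connected, of u v] by simp
  then have "M $ u $ v = M $ undefined $ undefined" for M :: "real ^ 'a ^ 'a" and u v
    by (metis (full_types))
  then show ?thesis
    unfolding bose_mesner_def
    by (intro exI[of _ "\<lambda>_. (adjacency_matrix R ** N) $ undefined $ undefined"]) blast
qed

lemma bose_mesner_mat_1: "bose_mesner R (mat 1)"
  unfolding bose_mesner_def mat_def
  by (intro exI[of _ "\<lambda>i. if i = 0 then 1 else 0"]) (simp add: gdist_eq_0_iff[OF distance_regular_connected])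

text \<open>The projection is found inside the algebra itself, without diagonalising \<open>A\<close>. Let
  \<open>B = A - \<theta> I\<close>. Orthogonal projection of \<open>I\<close> to the subspace of all \<open>B N\<close>, with \<open>N\<close> in the algebra,
  gives \<open>I = B N + Y\<close>. Since \<open>Y\<close> is orthogonal to \<open>B (B Y)\<close>, \<open>B Y = 0\<close>. So \<open>Y\<close> maps into
  the eigenspace, and \<open>I - Y = B N\<close> maps into the range of \<open>B\<close>, which is orthogonal to it; hence
  \<open>Y\<close> is the primitive idempotent.\<close>

lemma bose_mesner_primitive_idempotent: "bose_mesner R (primitive_idempotent R \<theta>)"
proof -
  define B where "B = adjacency_matrix R - \<theta> *\<^sub>R mat 1"
  have trB: "transpose B = B"
    using transpose_adjacency[OF distance_regular_connected]
    by (simp add: B_def transpose_def mat_def vec_eq_iff)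
  have Bv: "B *v v = adjacency_matrix R *v v - \<theta> *\<^sub>R v" for v
    by (simp add: B_def matrix_vector_mult_diff_rdistrib scaleR_matrix_vector_assoc[symmetric])
  have BN: "B ** N = adjacency_matrix R ** N - \<theta> *\<^sub>R N" for N
    by (simp add: B_def matrix_eq matrix_vector_mul_assoc[symmetric] matrix_vector_mult_diff_rdistrib
        scaleR_matrix_vector_assoc[symmetric])
  let ?M = "{N. bose_mesner R N}"
  have closed: "B ** N \<in> ?M" if "N \<in> ?M" for N
    using that subspace_bose_mesner[of R] bose_mesner_adjacency_mult unfolding BN
    by (intro subspace_diff subspace_scale) auto
  have "linear ((**) B)"
    by (rule linearI) (simp_all add: matrix_add_ldistrib matrix_eq matrix_vector_mul_assoc[symmetric]
        scaleR_matrix_vector_assoc[symmetric] matrix_vector_mult_scaleR matrix_vector_mult_add_rdistrib matrix_vector_right_distrib)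
  then have sub: "subspace ((**) B ` ?M)"
    using subspace_bose_mesner by (rule linear_subspace_image)
  obtain Z Y where Z: "Z \<in> span ((**) B ` ?M)"
    and Y: "\<And>W. W \<in> span ((**) B ` ?M) \<Longrightarrow> orthogonal Y W"
    and I: "mat 1 = Z + Y"
    using orthogonal_subspace_decomp_exists[of "(**) B ` ?M" "mat 1"] by metis
  obtain N where N: "N \<in> ?M" "Z = B ** N"
    using Z sub by (metis imageE span_eq_iff)
  have "mat 1 - Z \<in> ?M"
    using N closed bose_mesner_mat_1 subspace_bose_mesner by (intro subspace_diff) auto
  then have YM: "Y \<in> ?M"
    using I by (simp add: algebra_simps)
  have "(B ** Y) \<bullet> (B ** Y) = Y \<bullet> (B ** (B ** Y))"
    by (rule inner_matrix_mult_symmetric[OF trB])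
  also have "\<dots> = 0"
    using Y[of "B ** (B ** Y)"] YM closed by (simp add: span_base orthogonal_def)
  finally have BY: "B ** Y = 0"
    by simp
  have "is_orthogonal_projection Y (eigenspace (adjacency_matrix R) \<theta>)"
    unfolding is_orthogonal_projection_def
  proof (intro allI conjI ballI)
    fix v
    have "B *v (Y *v v) = 0"
      by (simp add: matrix_vector_mul_assoc BY)
    then show "Y *v v \<in> eigenspace (adjacency_matrix R) \<theta>"
      by (simp add: eigenspace_def Bv)
    fix w assume "w \<in> eigenspace (adjacency_matrix R) \<theta>"
    then have Bw: "B *v w = 0"
      by (simp add: eigenspace_def Bv)
    have "v = (B ** N) *v v + Y *v v"
      using I N by (metis matrix_vector_mul_lid matrix_vector_mult_add_rdistrib)
    then have "v - Y *v v = B *v (N *v v)"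
      by (simp add: matrix_vector_mul_assoc algebra_simps)
    then have "(v - Y *v v) \<bullet> w = (N *v v) \<bullet> (B *v w)"
      by (metis dot_lmul_matrix trB transpose_matrix_vector)
    then show "orthogonal (v - Y *v v) w"
      by (simp add: Bw orthogonal_def)
  qed
  then have "Y = primitive_idempotent R \<theta>"
    using orthogonal_projection_ex1[OF subspace_eigenspace]
      is_orthogonal_projection_primitive_idempotent by blast
  then show ?thesis
    using YM by simp
qed

section \<open>Intersection numbers near an edge\<close>

lemma card_Gamma_1: "1 \<le> diam R \<Longrightarrow> card (Gamma R 1 x) = valency R"
  using intersection_number_eq[OF dr, of 1 1 x x] gdist_eq_0_iff[OF distance_regular_connected, of x x]
  by (simp add: valency_def int_b_def)

lemma card_common_neighbours:
  assumes "1 \<le> diam R" "(x, y) \<in> R"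
  shows "card (common_neighbours R x y) = int_a R 1"
  using intersection_number_eq[OF dr assms(1) assms(1), of x y] assms
    gdist_eq_1_iff[OF distance_regular_connected, of x y]
  by (simp add: int_a_def common_neighbours_def)

lemma card_Gamma_1_2:
  assumes "2 \<le> diam R" "(x, y) \<in> R"
  shows "card (Gamma R 1 x \<inter> Gamma R 2 y) = int_b R 1"
  using intersection_number_eq[OF dr, of 1 2 x y] assms gdist_eq_1_iff[OF distance_regular_connected, of x y]
  by (simp add: int_b_def numeral_2_eq_2)

lemma Gamma_1_partition:
  assumes "(x, y) \<in> R"
  shows "Gamma R 1 x = insert y (common_neighbours R x y \<union> (Gamma R 1 x \<inter> Gamma R 2 y))"
proof -
  have "gdist R z y = 0 \<or> gdist R z y = 1 \<or> gdist R z y = 2" if "z \<in> Gamma R 1 x" for z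
  proof -
    have "gdist R z y \<le> gdist R z x + gdist R x y"
      by (rule gdist_triangle[OF distance_regular_connected])
    moreover have "gdist R z x = 1" "gdist R x y = 1"
      using that assms gdist_sym[OF distance_regular_connected] gdist_eq_1_iff[OF distance_regular_connected]
      by (auto simp: Gamma_def)
    ultimately show ?thesis
      by linarith
  qed
  moreover have "y \<in> Gamma R 1 x"
    using assms by (simp only: Gamma_1_eq[OF distance_regular_connected]) simp
  ultimately show ?thesis
    by (auto simp: common_neighbours_def Gamma_def gdist_sym[OF distance_regular_connected]
        gdist_eq_0_iff[OF distance_regular_connected])
qed

lemma sum_Gamma_1:
  fixes n :: "nat \<Rightarrow> real"
  assumes "2 \<le> diam R" "(x, y) \<in> R"
  shows "(\<Sum>z\<in>Gamma R 1 x. n (gdist R z y)) = n 0 + int_a R 1 * n 1 + int_b R 1 * n 2"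
proof -
  let ?C = "common_neighbours R x y" and ?D = "Gamma R 1 x \<inter> Gamma R 2 y"
  have C: "gdist R z y = 1" if "z \<in> ?C" for z
    using that by (simp add: common_neighbours_def Gamma_def gdist_sym[OF distance_regular_connected])
  have D: "gdist R z y = 2" if "z \<in> ?D" for z
    using that by (simp add: Gamma_def gdist_sym[OF distance_regular_connected])
  have y: "gdist R y y = 0"
    by (simp add: gdist_eq_0_iff[OF distance_regular_connected])
  have "y \<notin> ?C \<union> ?D" "?C \<inter> ?D = {}"
    using C D y by fastforce+
  then have "(\<Sum>z\<in>insert y (?C \<union> ?D). n (gdist R z y)) =
      n 0 + ((\<Sum>z\<in>?C. n (gdist R z y)) + (\<Sum>z\<in>?D. n (gdist R z y)))"
    by (simp add: y sum.union_disjoint)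
  also have "\<dots> = n 0 + (int_a R 1 * n 1 + int_b R 1 * n 2)"
    using C D assms card_common_neighbours[of x y] card_Gamma_1_2[of x y] by simp
  finally show ?thesis
    using Gamma_1_partition[OF assms(2)] by simp
qed

lemma valency_eq:
  assumes "2 \<le> diam R" "(x, y) \<in> R"
  shows "real (valency R) = 1 + int_a R 1 + int_b R 1"
  using sum_Gamma_1[OF assms, of "\<lambda>_. 1"] card_Gamma_1[of x] assms by simp

lemma int_b_1_pos:
  assumes "2 \<le> diam R"
  shows "0 < int_b R 1"
proof -
  obtain x y z where *: "(x, y) \<in> R" "(y, z) \<in> R" "gdist R x z = 2"
    using ex_gdist_2[OF distance_regular_connected assms] by metis
  then have "z \<in> Gamma R 1 y \<inter> Gamma R 2 x"
    using gdist_eq_1_iff[OF distance_regular_connected, of y z] by (simp add: Gamma_def)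
  then show ?thesis
    using card_Gamma_1_2[of y x] assms * edge_sym[OF distance_regular_connected]
    by (metis card_gt_0_iff empty_iff finite)
qed


end

section \<open>Tightness as a vanishing Gram determinant\<close>

text \<open>The hypotheses on \<open>p\<close> and \<open>q\<close> make \<open>u\<close> and \<open>v\<close> independent. By symmetry the orthogonal projection
  of \<open>w\<close> to their span is a multiple of \<open>u + v\<close>, namely \<open>s / (p + q)\<close> times it. The
  squared length of the residual is the Gram determinant up to a positive factor.\<close>

lemma dependent_iff_gram_symmetric:
  fixes u v w :: "'b::real_inner"
  assumes uu: "u \<bullet> u = p" and vv: "v \<bullet> v = p" and uv: "u \<bullet> v = q"
    and uw: "u \<bullet> w = s" and vw: "v \<bullet> w = s" and pq: "0 < p + q" "q < p"
  shows "2 * s\<^sup>2 \<le> (p + q) * (w \<bullet> w)"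
    and "(\<exists>\<alpha> \<beta> \<gamma>. (\<alpha>, \<beta>, \<gamma>) \<noteq> (0, 0, 0) \<and> \<alpha> *\<^sub>R u + \<beta> *\<^sub>R v + \<gamma> *\<^sub>R w = 0)
      \<longleftrightarrow> (p + q) * (w \<bullet> w) = 2 * s\<^sup>2"
proof -
  let ?r = "(p + q) *\<^sub>R w - s *\<^sub>R (u + v)"
  have inner_simps: "v \<bullet> u = q" "w \<bullet> u = s" "w \<bullet> v = s"
    using uv uw vw by (simp_all add: inner_commute)
  have r: "?r \<bullet> ?r = (p + q) * ((p + q) * (w \<bullet> w) - 2 * s\<^sup>2)"
    by (simp add: inner_diff_left inner_diff_right inner_add_left inner_add_right assms inner_simps
        algebra_simps power2_eq_square)
  have "0 \<le> ?r \<bullet> ?r"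
    by simp
  then show "2 * s\<^sup>2 \<le> (p + q) * (w \<bullet> w)"
    unfolding r using pq by (simp add: zero_le_mult_iff)
  show "(\<exists>\<alpha> \<beta> \<gamma>. (\<alpha>, \<beta>, \<gamma>) \<noteq> (0, 0, 0) \<and> \<alpha> *\<^sub>R u + \<beta> *\<^sub>R v + \<gamma> *\<^sub>R w = 0)
      \<longleftrightarrow> (p + q) * (w \<bullet> w) = 2 * s\<^sup>2" (is "?L \<longleftrightarrow> _")
  proof
    assume "(p + q) * (w \<bullet> w) = 2 * s\<^sup>2"
    then have "?r = 0"
      using r by simp
    then have "(- s) *\<^sub>R u + (- s) *\<^sub>R v + (p + q) *\<^sub>R w = 0"
      by (simp add: algebra_simps)
    then show ?L
      using pq by (intro exI[of _ "- s"] exI[of _ "p + q"]) auto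
  next
    assume ?L
    then obtain \<alpha> \<beta> \<gamma> where nz: "(\<alpha>, \<beta>, \<gamma>) \<noteq> (0, 0, 0)"
      and eq: "\<alpha> *\<^sub>R u + \<beta> *\<^sub>R v + \<gamma> *\<^sub>R w = 0"
      by blast
    have "(\<alpha> *\<^sub>R u + \<beta> *\<^sub>R v + \<gamma> *\<^sub>R w) \<bullet> z = 0" for z
      unfolding eq by simp
    from this[of u] this[of v] this[of w]
    have e: "\<alpha> * p + \<beta> * q + \<gamma> * s = 0" "\<alpha> * q + \<beta> * p + \<gamma> * s = 0"
      "\<alpha> * s + \<beta> * s + \<gamma> * (w \<bullet> w) = 0"
      by (simp_all add: inner_add_left assms inner_simps)
    have "(\<alpha> - \<beta>) * (p - q) = 0"
      using e(1,2) by (simp add: algebra_simps)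
    then have ab: "\<alpha> = \<beta>"
      using pq by simp
    have e1: "\<alpha> * (p + q) + \<gamma> * s = 0" and e2: "2 * \<alpha> * s + \<gamma> * (w \<bullet> w) = 0"
      using e ab by (simp_all add: algebra_simps)
    have "\<gamma> \<noteq> 0"
      using e1 nz ab pq by auto
    moreover have "\<gamma> * ((p + q) * (w \<bullet> w) - 2 * s\<^sup>2) =
        (p + q) * (2 * \<alpha> * s + \<gamma> * (w \<bullet> w)) - 2 * s * (\<alpha> * (p + q) + \<gamma> * s)"
      by (simp add: algebra_simps power2_eq_square)
    ultimately show "(p + q) * (w \<bullet> w) = 2 * s\<^sup>2"
      using e1 e2 by simp
  qed
qed

context
  fixes R :: "('a::finite \<times> 'a) set"
  assumes dr: "distance_regular R"
begin

text \<open>Two common neighbours of an edge are at distance at most 2, so the distribution of their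
  mutual distances is determined by \<open>a\<^sub>1\<close> and \<open>f\<close>.\<close>

lemma sum_common_neighbours_pairs:
  fixes n :: "nat \<Rightarrow> real"
  assumes "1 \<le> diam R" "(x, y) \<in> R" "int_a R 1 \<noteq> 0"
  shows "(\<Sum>z\<in>common_neighbours R x y. \<Sum>w\<in>common_neighbours R x y. n (gdist R z w)) =
    int_a R 1 * (n 0 + (real (int_a R 1) - 1 - edge_f R x y) * n 1 + edge_f R x y * n 2)"
proof -
  note conn = distance_regular_connected[OF dr]
  let ?C = "common_neighbours R x y"
  let ?a = "real (int_a R 1)"
  let ?T = "{(z, w). z \<in> ?C \<and> w \<in> ?C \<and> gdist R z w = 2}"
  have C: "real (card ?C) = ?a"
    using card_common_neighbours[OF dr assms(1,2)] by simp
  have T: "real (card ?T) = ?a * edge_f R x y"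
    using assms(3) by (simp add: edge_f_def)
  have "n (gdist R z w) = n 1 + (if z = w then n 0 - n 1 else 0) +
      (if gdist R z w = 2 then n 2 - n 1 else 0)" if "z \<in> ?C" "w \<in> ?C" for z w
  proof -
    have "gdist R z w \<le> gdist R z x + gdist R x w"
      by (rule gdist_triangle[OF conn])
    also have "\<dots> = 2"
      using that by (simp add: common_neighbours_def Gamma_def gdist_sym[OF conn, of z x])
    finally have "gdist R z w = 0 \<or> gdist R z w = 1 \<or> gdist R z w = 2"
      by linarith
    then show ?thesis
      using gdist_eq_0_iff[OF conn, of z w] by auto
  qed
  then have "(\<Sum>z\<in>?C. \<Sum>w\<in>?C. n (gdist R z w)) =
      (\<Sum>z\<in>?C. \<Sum>w\<in>?C. n 1 + (if z = w then n 0 - n 1 else 0) +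
        (if gdist R z w = 2 then n 2 - n 1 else 0))"
    by (intro sum.cong refl) blast
  also have "\<dots> = ?a * ?a * n 1 + ?a * (n 0 - n 1) +
      (\<Sum>z\<in>?C. \<Sum>w\<in>?C. if gdist R z w = 2 then n 2 - n 1 else 0)"
    by (simp add: sum.distrib C distrib_left mult.assoc)
  also have "(\<Sum>z\<in>?C. \<Sum>w\<in>?C. if gdist R z w = 2 then n 2 - n 1 else 0) =
      (\<Sum>(z, w)\<in>?C \<times> ?C. if gdist R z w = 2 then n 2 - n 1 else 0)"
    by (rule sum.cartesian_product)
  also have "\<dots> = (\<Sum>p\<in>?C \<times> ?C. if p \<in> ?T then n 2 - n 1 else 0)"
    by (intro sum.cong refl) clarsimp
  also have "\<dots> = real (card ((?C \<times> ?C) \<inter> ?T)) * (n 2 - n 1)"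
    by (simp add: sum.If_cases)
  also have "(?C \<times> ?C) \<inter> ?T = ?T"
    by auto
  finally show ?thesis
    by (simp add: T algebra_simps)
qed

text \<open>Here \<open>\<Phi>\<close> is, up to a positive factor, the Gram determinant of the three vectors that define
  tightness; it depends on the edge only through \<open>edge_f\<close>.\<close>

lemma tight_edge_bound:
  fixes \<theta> :: real
  assumes diam: "2 \<le> diam R" and a: "int_a R 1 \<noteq> 0" and edge: "(x, y) \<in> R"
    and \<theta>: "\<theta> \<in> eigenvalues R" "\<theta> < valency R"
  defines "\<Phi> \<equiv> int_b R 1 * (valency R + \<theta> * (int_a R 1 + 1)) -
    (valency R + \<theta>) * (1 + \<theta>) * edge_f R x y"
  shows "- real (valency R) < \<theta>" and "0 \<le> \<Phi>" and "tight_edge R \<theta> x y \<longleftrightarrow> \<Phi> = 0"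
proof -
  note conn = distance_regular_connected[OF dr]
  let ?E = "primitive_idempotent R \<theta>"
  let ?C = "common_neighbours R x y"
  define K \<alpha> b f where "K = real (valency R)" and "\<alpha> = real (int_a R 1)"
    and "b = real (int_b R 1)" and "f = edge_f R x y"
  have b: "b > 0" and \<alpha>: "\<alpha> > 0" and K: "K = 1 + \<alpha> + b"
    using int_b_1_pos[OF dr diam] a valency_eq[OF dr diam edge]
    by (simp_all add: K_def \<alpha>_def b_def)
  obtain g where g: "\<And>u v. ?E $ u $ v = g (gdist R u v)"
    using bose_mesner_primitive_idempotent[OF dr] unfolding bose_mesner_def by blast
  define e where "e z = ?E *v axis z 1" for z
  have ee: "e z \<bullet> e w = g (gdist R z w)" for z w
    unfolding e_def inner_primitive_idempotent_axis by (rule g)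
  have d0: "gdist R z z = 0" for z
    by (simp add: gdist_eq_0_iff[OF conn])
  have dxy: "gdist R x y = 1"
    using edge gdist_eq_1_iff[OF conn] by simp
  have g0: "g 0 > 0"
  proof (rule ccontr)
    assume "\<not> g 0 > 0"
    then have "e z \<bullet> e z = 0" for z
      using ee[of z z] inner_ge_zero[of "e z"] unfolding d0 by linarith
    then have "column z ?E = 0" for z
      by (simp add: e_def matrix_vector_mult_basis)
    then have E0: "?E = 0"
      by (simp add: vec_eq_iff column_def)
    obtain v where v: "v \<noteq> 0" "v \<in> eigenspace (adjacency_matrix R) \<theta>"
      using \<theta>(1) by (auto simp: eigenvalues_def eigenspace_def)
    show False
      using primitive_idempotent_fixes[OF v(2)] v(1) by (simp add: E0)
  qed
  have rec: "(\<Sum>z\<in>Gamma R 1 u. g (gdist R z v)) = \<theta> * g (gdist R u v)" for u v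
  proof -
    have "adjacency_matrix R *v e v = \<theta> *\<^sub>R e v"
      using primitive_idempotent_mem[of R \<theta> "axis v 1"] by (simp add: eigenspace_def e_def)
    then have "(\<Sum>z\<in>Gamma R 1 u. e v $ z) = \<theta> * e v $ u"
      using adjacency_apply[OF conn, of "e v" u] by simp
    moreover have "e v $ z = g (gdist R z v)" for z
      by (simp add: e_def matrix_vector_mult_basis column_def g)
    ultimately show ?thesis
      by simp
  qed
  \<comment> \<open>The equation \<open>A E = \<theta> E\<close> at the entry \<open>(x, x)\<close>.\<close>
  have Kg: "K * g 1 = \<theta> * g 0"
  proof -
    have "(\<Sum>z\<in>Gamma R 1 x. g (gdist R z x)) = (\<Sum>z\<in>Gamma R 1 x. g 1)"
      by (rule sum.cong) (auto simp: Gamma_def gdist_sym[OF conn, of _ x])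
    then show ?thesis
      using rec[of x x] card_Gamma_1[OF dr, of x] diam by (simp add: d0 K_def)
  qed
  \<comment> \<open>The equation \<open>A E = \<theta> E\<close> at the entry \<open>(x, y)\<close>.\<close>
  have bg: "g 0 + \<alpha> * g 1 + b * g 2 = \<theta> * g 1"
    using rec[of y x] sum_Gamma_1[OF dr diam edge, of g] by (simp add: dxy \<alpha>_def b_def)
  define w where "w = (\<Sum>z\<in>?C. e z)"
  have cardC: "real (card ?C) = \<alpha>"
    using card_common_neighbours[OF dr _ edge] diam by (simp add: \<alpha>_def)
  have xw: "e x \<bullet> w = \<alpha> * g 1" and yw: "e y \<bullet> w = \<alpha> * g 1"
    unfolding w_def inner_sum_right ee using cardC
    by (simp_all add: common_neighbours_def Gamma_def)
  have ww: "w \<bullet> w = \<alpha> * (g 0 + (\<alpha> - 1 - f) * g 1 + f * g 2)"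
    unfolding w_def inner_sum_left inner_sum_right ee
    using sum_common_neighbours_pairs[OF _ edge a, of g] diam
    by (simp add: \<alpha>_def f_def gdist_sym[OF conn])
  have norm_xy: "(e x + e y) \<bullet> (e x + e y) = 2 * (g 0 + g 1)"
    by (simp add: inner_add_left inner_add_right ee d0 dxy gdist_sym[OF conn, of y x])
  \<comment> \<open>If \<open>g 0 + g 1 = 0\<close>, then \<open>E x = - E y\<close>, although both have the same inner product
    \<open>\<alpha> * g 1 \<noteq> 0\<close> with \<open>w\<close>: here the triangles of the graph exclude the eigenvalue \<open>-k\<close>.\<close>
  have pq: "g 0 + g 1 > 0"
  proof (rule ccontr)
    assume "\<not> g 0 + g 1 > 0"
    moreover have "0 \<le> 2 * (g 0 + g 1)"
      unfolding norm_xy[symmetric] by simp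
    ultimately have 0: "g 0 + g 1 = 0"
      by (intro order_antisym) simp_all
    then have "(e x + e y) \<bullet> (e x + e y) = 0"
      using norm_xy by simp
    then have "(e x + e y) \<bullet> w = 0"
      by simp
    then have "\<alpha> * g 1 = 0"
      by (simp add: inner_add_left xw yw)
    then show False
      using 0 \<alpha> g0 by simp
  qed
  have Kpos: "K > 0"
    using K \<alpha> b by simp
  have "(K + \<theta>) * g 0 = K * (g 0 + g 1)"
    using Kg by (simp add: algebra_simps)
  then have "(K + \<theta>) * g 0 > 0"
    using pq Kpos by simp
  then have "K + \<theta> > 0"
    using g0 by (simp add: zero_less_mult_iff)
  then show "- real (valency R) < \<theta>"
    by (simp add: K_def)
  have "K * (g 0 - g 1) = (K - \<theta>) * g 0"
    using Kg by (simp add: algebra_simps)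
  then have qp: "g 1 < g 0"
    using g0 \<theta>(2) Kpos by (metis K_def diff_gt_0_iff_gt mult_pos_pos zero_less_mult_pos)
  define \<Delta> where "\<Delta> = (g 0 + g 1) * (w \<bullet> w) - 2 * (\<alpha> * g 1)\<^sup>2"
  note gram = dependent_iff_gram_symmetric[of "e x" "g 0" "e y" "g 1" w "\<alpha> * g 1",
      OF _ _ _ xw yw pq qp, unfolded ee d0 dxy, OF refl refl refl]
  have \<Delta>: "0 \<le> \<Delta>" "tight_edge R \<theta> x y \<longleftrightarrow> \<Delta> = 0"
    using gram by (simp_all add: \<Delta>_def tight_edge_def Let_def e_def w_def)
  have \<Phi>: "\<Phi> = b * (K + \<theta> * (\<alpha> + 1)) - (K + \<theta>) * (1 + \<theta>) * f"
    by (simp add: \<Phi>_def K_def \<alpha>_def b_def f_def add.commute)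
  have factor: "K * b * \<Delta> = \<alpha> * g 0 * (g 0 - g 1) * \<Phi>"
  proof -
    \<comment> \<open>The ratio of the entries of \<open>E\<close> at distances 1 and 0.\<close>
    define \<sigma> where "\<sigma> = \<theta> / K"
    have g1: "g 1 = \<sigma> * g 0" and th: "\<theta> = K * \<sigma>"
      using Kg Kpos by (simp_all add: \<sigma>_def field_simps)
    have bg2: "b * g 2 = (\<theta> * \<sigma> - 1 - \<alpha> * \<sigma>) * g 0"
      using bg unfolding g1 by (simp add: algebra_simps)
    have "b * (w \<bullet> w) = \<alpha> * (b * g 0 + b * (\<alpha> - 1 - f) * g 1 + f * (b * g 2))"
      by (simp add: ww algebra_simps)
    also have "\<dots> = \<alpha> * g 0 * (b * (1 - \<sigma> + \<alpha> * \<sigma>) - f * (1 + \<theta>) * (1 - \<sigma>))"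
      unfolding bg2 g1 th K by (simp add: algebra_simps)
    finally have bww: "b * (w \<bullet> w) =
        \<alpha> * g 0 * (b * (1 - \<sigma> + \<alpha> * \<sigma>) - f * (1 + \<theta>) * (1 - \<sigma>))" .
    have "K * b * \<Delta> = K * (1 + \<sigma>) * g 0 * (b * (w \<bullet> w)) - 2 * K * b * (\<alpha> * \<sigma> * g 0)\<^sup>2"
      unfolding \<Delta>_def g1 by (simp add: algebra_simps)
    also have "\<dots> = \<alpha> * g 0 * (g 0 - g 1) * \<Phi>"
      unfolding bww \<Phi> g1 th by (simp add: algebra_simps power2_eq_square)
    finally show ?thesis .
  qed
  have pos: "K * b > 0" "\<alpha> * g 0 * (g 0 - g 1) > 0"
    using Kpos b \<alpha> g0 qp by simp_all
  show "0 \<le> \<Phi>"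
    using \<Delta>(1) factor pos by (metis less_imp_le mult_nonneg_nonneg zero_le_mult_iff not_less)
  show "tight_edge R \<theta> x y \<longleftrightarrow> \<Phi> = 0"
    using \<Delta>(2) factor pos by (metis less_irrefl mult_eq_0_iff)
qed

section \<open>The largest and the smallest nontrivial eigenvalue\<close>

text \<open>The Laplacian form. Its nonnegativity bounds the eigenvalues by \<open>k\<close>, and the vectors where it
  vanishes are constant by connectedness.\<close>

lemma adjacency_Dirichlet_form:
  assumes "1 \<le> diam R"
  shows "2 * (valency R * (v \<bullet> v) - v \<bullet> (adjacency_matrix R *v v)) =
    (\<Sum>u\<in>UNIV. \<Sum>z\<in>Gamma R 1 u. (v $ u - v $ z)\<^sup>2)"
proof -
  note conn = distance_regular_connected[OF dr]
  have 1: "(\<Sum>u\<in>UNIV. \<Sum>z\<in>Gamma R 1 u. (v $ u)\<^sup>2) = valency R * (v \<bullet> v)"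
    using card_Gamma_1[OF dr assms]
    by (simp add: inner_vec_def power2_eq_square sum_distrib_left)
  have "(\<Sum>u\<in>UNIV. \<Sum>z\<in>Gamma R 1 u. (v $ z)\<^sup>2) = (\<Sum>z\<in>UNIV. \<Sum>u\<in>Gamma R 1 z. (v $ z)\<^sup>2)"
    using sum.swap_restrict[of UNIV UNIV "\<lambda>u z. (v $ z)\<^sup>2" "\<lambda>u z. (u, z) \<in> R"]
    by (simp add: Gamma_1_eq[OF conn] edge_sym[OF conn] del: One_nat_def)
  then have 2: "(\<Sum>u\<in>UNIV. \<Sum>z\<in>Gamma R 1 u. (v $ z)\<^sup>2) = valency R * (v \<bullet> v)"
    using 1 by simp
  have 3: "(\<Sum>u\<in>UNIV. \<Sum>z\<in>Gamma R 1 u. v $ u * v $ z) = v \<bullet> (adjacency_matrix R *v v)"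
    by (simp add: inner_vec_def adjacency_apply[OF conn] sum_distrib_left)
  have "(\<Sum>u\<in>UNIV. \<Sum>z\<in>Gamma R 1 u. (v $ u - v $ z)\<^sup>2) =
      (\<Sum>u\<in>UNIV. \<Sum>z\<in>Gamma R 1 u. (v $ u)\<^sup>2) + (\<Sum>u\<in>UNIV. \<Sum>z\<in>Gamma R 1 u. (v $ z)\<^sup>2)
      - 2 * (\<Sum>u\<in>UNIV. \<Sum>z\<in>Gamma R 1 u. v $ u * v $ z)"
    by (simp add: power2_diff sum.distrib sum_subtractf sum_distrib_left mult.assoc)
  then show ?thesis
    unfolding 1 2 3 by simp
qed

lemma eigenvalue_le_valency:
  assumes "1 \<le> diam R" "\<theta> \<in> eigenvalues R"
  shows "\<theta> \<le> valency R"
proof -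
  obtain v where v: "v \<noteq> 0" "adjacency_matrix R *v v = \<theta> *\<^sub>R v"
    using assms(2) by (auto simp: eigenvalues_def)
  have "0 \<le> 2 * (valency R * (v \<bullet> v) - v \<bullet> (adjacency_matrix R *v v))"
    unfolding adjacency_Dirichlet_form[OF assms(1)] by (intro sum_nonneg) simp
  then have "\<theta> * (v \<bullet> v) \<le> valency R * (v \<bullet> v)"
    by (simp add: v)
  then show ?thesis
    using v(1) by simp
qed

lemma valency_eigenvector_constant:
  assumes "1 \<le> diam R" "adjacency_matrix R *v v = real (valency R) *\<^sub>R v"
  shows "v $ x = v $ y"
proof -
  note conn = distance_regular_connected[OF dr]
  have "(\<Sum>u\<in>UNIV. \<Sum>z\<in>Gamma R 1 u. (v $ u - v $ z)\<^sup>2) = 0"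
    unfolding adjacency_Dirichlet_form[OF assms(1), symmetric] by (simp add: assms(2))
  then have step: "v $ u = v $ z" if "(u, z) \<in> R" for u z
    using that by (simp add: sum_nonneg_eq_0_iff sum_nonneg Gamma_1_eq[OF conn] del: One_nat_def)
  have "(x, y) \<in> R\<^sup>*"
    using conn by (simp add: connected_simple_graph_def)
  then show ?thesis
    by (induction rule: rtrancl_induct) (auto dest: step)
qed

lemma adjacency_all_ones:
  assumes "1 \<le> diam R"
  shows "adjacency_matrix R *v (\<chi> i. 1) = real (valency R) *\<^sub>R (\<chi> i. 1)"
  by (simp only: vec_eq_iff adjacency_apply[OF distance_regular_connected[OF dr]])
    (simp add: card_Gamma_1[OF dr assms, simplified])

lemma valency_eigenvalue: "1 \<le> diam R \<Longrightarrow> real (valency R) \<in> eigenvalues R"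
  unfolding eigenvalues_def mem_Collect_eq
  by (rule exI[of _ "\<chi> i. 1"]) (simp add: adjacency_all_ones vec_eq_iff)

lemma inner_axis_adjacency_axis:
  "axis u 1 \<bullet> (adjacency_matrix R *v axis v 1) = (if (u, v) \<in> R then 1 else 0)"
  by (simp add: inner_axis' matrix_vector_mult_basis column_def adjacency_matrix_def)

text \<open>The difference of two nonadjacent vertices is orthogonal to the constants, and the adjacency
  form vanishes on it. So the largest eigenvalue on the complement of the constants is nonnegative;
  it is not \<open>k\<close>, whose eigenvectors are constant.\<close>

lemma ex_nontrivial_eigenvalue_ge_0:
  assumes "2 \<le> diam R"
  obtains \<theta> where "\<theta> \<in> eigenvalues R" "0 \<le> \<theta>" "\<theta> < valency R"
proof -
  note conn = distance_regular_connected[OF dr]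
  obtain x y z where xz: "gdist R x z = 2"
    using ex_gdist_2[OF conn assms] by metis
  then have ne: "x \<noteq> z" "(x, z) \<notin> R" "(z, x) \<notin> R"
    using gdist_eq_0_iff[OF conn, of x z] gdist_eq_1_iff[OF conn, of x z] edge_sym[OF conn] by auto
  let ?S = "{v. (\<chi> i. 1) \<bullet> v = (0::real)} :: (real ^ 'a) set"
  define u :: "real ^ 'a" where "u = axis x 1 - axis z 1"
  have uS: "u \<in> ?S"
    by (simp add: u_def inner_diff_right inner_axis)
  have uu: "u \<bullet> u = 2"
    using ne by (simp add: u_def inner_diff_left inner_diff_right inner_axis_axis)
  have inv: "adjacency_matrix R *v v \<in> ?S" if "v \<in> ?S" for v
    using that adjacency_selfadjoint[OF conn, of "\<chi> i. 1" v] adjacency_all_ones assms by simp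
  have nontriv: "?S \<noteq> {0}"
    using uS uu by (metis inner_zero_left singletonD zero_neq_numeral)
  obtain v \<mu> where v: "v \<in> ?S" "v \<noteq> 0" "adjacency_matrix R *v v = \<mu> *\<^sub>R v"
    and max: "\<forall>u\<in>?S. u \<bullet> (adjacency_matrix R *v u) \<le> \<mu> * (u \<bullet> u)"
    by (rule selfadjoint_max_eigenvector[OF matrix_vector_mul_linear subspace_hyperplane nontriv
          inv adjacency_selfadjoint[OF conn]]) blast
  have "u \<bullet> (adjacency_matrix R *v u) = 0"
    using ne no_loop[OF conn]
    by (simp add: u_def matrix_vector_mult_diff_distrib inner_diff_left inner_diff_right
        inner_axis_adjacency_axis)
  then have "0 \<le> \<mu>"
    using bspec[OF max uS] uu by simp
  moreover have ev: "\<mu> \<in> eigenvalues R"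
    using v by (auto simp: eigenvalues_def)
  moreover have "\<mu> \<noteq> valency R"
  proof
    assume "\<mu> = valency R"
    then have const: "v $ i = v $ x" for i
      using valency_eigenvector_constant[of v i x] v(3) assms by simp
    have "0 = (\<Sum>i\<in>UNIV. v $ i)"
      using v(1) by (simp add: inner_vec_def)
    also have "\<dots> = (\<Sum>i\<in>(UNIV :: 'a set). v $ x)"
      by (rule sum.cong[OF refl const])
    finally have "v $ x = 0"
      by simp
    then have "v $ i = 0" for i
      using const[of i] by simp
    then have "v = 0"
      by (simp add: vec_eq_iff)
    then show False
      using v(2) by simp
  qed
  moreover have "\<mu> \<le> valency R"
    using eigenvalue_le_valency ev assms by simp
  ultimately show ?thesis
    by (intro that[of \<mu>]) auto
qed

text \<open>For an induced path \<open>x, y, z\<close> the vector \<open>x - y + z\<close> has Rayleigh quotient \<open>-4/3\<close>.\<close>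

lemma ex_eigenvalue_less_minus_1:
  assumes "2 \<le> diam R"
  obtains \<theta> where "\<theta> \<in> eigenvalues R" "\<theta> < - 1"
proof -
  note conn = distance_regular_connected[OF dr]
  obtain x y z where e: "(x, y) \<in> R" "(y, z) \<in> R" and xz: "gdist R x z = 2"
    using ex_gdist_2[OF conn assms] by metis
  then have ne: "x \<noteq> z" "(x, z) \<notin> R" "(z, x) \<notin> R" "x \<noteq> y" "y \<noteq> z" "(y, x) \<in> R" "(z, y) \<in> R"
    using gdist_eq_0_iff[OF conn, of x z] gdist_eq_1_iff[OF conn, of x z] edge_sym[OF conn]
      no_loop[OF conn] by auto
  define u :: "real ^ 'a" where "u = axis x 1 - axis y 1 + axis z 1"
  have uu: "u \<bullet> u = 3"
    using ne by (simp add: u_def inner_simps inner_axis_axis)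
  have uAu: "u \<bullet> (adjacency_matrix R *v u) = - 4"
    using ne e no_loop[OF conn]
    by (simp add: u_def matrix_vector_mult_diff_distrib matrix_vector_right_distrib inner_simps
        inner_axis_adjacency_axis)
  have lin: "linear (\<lambda>v. - (adjacency_matrix R *v v))"
    by (intro linear_compose_neg matrix_vector_mul_linear)
  have nontriv: "(UNIV :: (real ^ 'a) set) \<noteq> {0}"
    using uu by (metis UNIV_I inner_zero_left singletonD zero_neq_numeral)
  obtain v \<mu> where v: "v \<noteq> 0" "- (adjacency_matrix R *v v) = \<mu> *\<^sub>R v"
    and max: "\<forall>u. u \<bullet> - (adjacency_matrix R *v u) \<le> \<mu> * (u \<bullet> u)"
    by (rule selfadjoint_max_eigenvector[OF lin subspace_UNIV nontriv])
      (auto simp: adjacency_selfadjoint[OF conn])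
  have "- \<mu> \<in> eigenvalues R"
    unfolding eigenvalues_def using v by (metis (mono_tags, lifting) mem_Collect_eq minus_equation_iff scaleR_minus_left)
  moreover have "- \<mu> < - 1"
    using spec[OF max, of u] uu uAu by simp
  ultimately show ?thesis
    by (rule that)
qed

end

section \<open>Comparing the bounds of different eigenvalues\<close>

text \<open>Both numerators on the right are positive in the situation of interest, where
  \<open>K - \<alpha> - 1 = b\<^sub>1\<close>. This makes the monotonicity of the ratio evident.\<close>

lemma tightness_ratio_partial_fractions:
  fixes K \<alpha> t :: real
  assumes "K + t \<noteq> 0" "1 + t \<noteq> 0" "K \<noteq> 1"
  shows "(K + t * (\<alpha> + 1)) / ((K + t) * (1 + t)) =
    ((K - \<alpha> - 1) / (1 + t) + K * \<alpha> / (K + t)) / (K - 1)"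
proof -
  have "(K - \<alpha> - 1) / (1 + t) + K * \<alpha> / (K + t) =
      ((K - \<alpha> - 1) * (K + t) + K * \<alpha> * (1 + t)) / ((K + t) * (1 + t))"
    using assms by (simp add: add_frac_eq mult.commute)
  also have "(K - \<alpha> - 1) * (K + t) + K * \<alpha> * (1 + t) = (K + t * (\<alpha> + 1)) * (K - 1)"
    by (simp add: algebra_simps)
  finally show ?thesis
    using assms by simp
qed

lemma tightness_ratio_strict_antimono:
  fixes K \<alpha> s t :: real
  assumes "0 < \<alpha>" "\<alpha> + 1 < K" "- K < s" "s < t" "t < - 1 \<or> - 1 < s"
  shows "(K + t * (\<alpha> + 1)) / ((K + t) * (1 + t)) < (K + s * (\<alpha> + 1)) / ((K + s) * (1 + s))"
proof -
  have "(1 + s) * (1 + t) > 0"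
    using assms by (auto simp: zero_less_mult_iff)
  then have "(K - \<alpha> - 1) / (1 + t) < (K - \<alpha> - 1) / (1 + s)"
    using assms by (intro divide_strict_left_mono) (auto simp: mult.commute)
  moreover have "K * \<alpha> / (K + t) < K * \<alpha> / (K + s)"
    using assms by (intro divide_strict_left_mono) auto
  ultimately show ?thesis
    using assms by (subst (1 2) tightness_ratio_partial_fractions) (auto intro: divide_strict_right_mono)
qed

theorem corollary3p6:
  fixes R :: "('a::finite \<times> 'a) set" and \<theta> :: "nat \<Rightarrow> real" and x y :: 'a
  assumes "distance_regular R"
    and "diam R \<ge> 3"
    and "int_a R 1 \<noteq> 0"
    and "strict_antimono_on {0..diam R} \<theta>"
    and "\<theta> ` {0..diam R} = eigenvalues R"
    and "(x, y) \<in> R"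
  shows "(tight_edge R (\<theta> 1) x y \<longleftrightarrow>
            edge_f R x y =
              real (int_b R 1) *
              ((real (valency R) + \<theta> 1 * (real (int_a R 1) + 1)) /
               ((real (valency R) + \<theta> 1) * (1 + \<theta> 1))))
       \<and> (tight_edge R (\<theta> (diam R)) x y \<longleftrightarrow>
            edge_f R x y =
              real (int_b R 1) *
              ((real (valency R) + \<theta> (diam R) * (real (int_a R 1) + 1)) /
               ((real (valency R) + \<theta> (diam R)) * (1 + \<theta> (diam R)))))
       \<and> (\<forall>i \<in> {2..diam R - 1}. \<not> tight_edge R (\<theta> i) x y)"
proof -
  have diam: "2 \<le> diam R" "1 \<le> diam R"
    using assms(2) by auto
  define d where "d = diam R"
  define K \<alpha> b f where "K = real (valency R)" and "\<alpha> = real (int_a R 1)"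
    and "b = real (int_b R 1)" and "f = edge_f R x y"
  have b: "b > 0" and \<alpha>: "\<alpha> > 0" and K: "K = 1 + \<alpha> + b"
    using int_b_1_pos[OF assms(1) diam(1)] assms(3) valency_eq[OF assms(1) diam(1) assms(6)]
    by (simp_all add: K_def \<alpha>_def b_def)
  have less: "\<theta> j < \<theta> i" if "i < j" "j \<le> d" for i j
    using assms(4) that unfolding monotone_on_def d_def by auto
  have le: "\<theta> j \<le> \<theta> i" if "i \<le> j" "j \<le> d" for i j
    using less[of i j] that by (cases "i = j") auto
  have ev: "\<theta> i \<in> eigenvalues R" if "i \<le> d" for i
    using assms(5) that unfolding d_def by auto
  have index: "\<exists>i\<le>d. t = \<theta> i" if "t \<in> eigenvalues R" for t
    using assms(5) that unfolding d_def by (metis atLeastAtMost_iff imageE)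
  have \<theta>0: "K \<le> \<theta> 0"
    using index[OF valency_eigenvalue[OF assms(1) diam(2)]] le unfolding K_def by fastforce
  have ltK: "\<theta> i < K" if "1 \<le> i" "i \<le> d" for i
    using less[of 0 i] that eigenvalue_le_valency[OF assms(1) diam(2) ev[of 0]] by (simp add: K_def)
  have \<theta>1: "- 1 < \<theta> 1"
  proof -
    obtain t where "t \<in> eigenvalues R" "0 \<le> t" "t < K"
      using ex_nontrivial_eigenvalue_ge_0[OF assms(1) diam(1)] unfolding K_def by metis
    then obtain i where i: "i \<le> d" "0 \<le> \<theta> i" "\<theta> i < K"
      using index by metis
    then have "i \<noteq> 0"
      using \<theta>0 by (metis leD)
    then show ?thesis
      using le[of 1 i] i by simp
  qed
  have \<theta>d: "\<theta> d < - 1"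
  proof -
    obtain t where "t \<in> eigenvalues R" "t < - 1"
      using ex_eigenvalue_less_minus_1[OF assms(1) diam(1)] by metis
    then show ?thesis
      using index le[of _ d] by fastforce
  qed
  define F where "F t = (K + t * (\<alpha> + 1)) / ((K + t) * (1 + t))" for t
  have bound: "- K < \<theta> i" "(K + \<theta> i) * (1 + \<theta> i) * f \<le> b * (K + \<theta> i * (\<alpha> + 1))"
    "tight_edge R (\<theta> i) x y \<longleftrightarrow> (K + \<theta> i) * (1 + \<theta> i) * f = b * (K + \<theta> i * (\<alpha> + 1))"
    if "1 \<le> i" "i \<le> d" for i
    using tight_edge_bound[OF assms(1) diam(1) assms(3,6) ev[OF that(2)]] ltK[OF that]
    by (auto simp: K_def \<alpha>_def b_def f_def add.commute)
  have tight_iff: "tight_edge R (\<theta> i) x y \<longleftrightarrow> f = b * F (\<theta> i)"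
    if "1 \<le> i" "i \<le> d" "\<theta> i \<noteq> - 1" for i
  proof -
    have "(K + \<theta> i) * (1 + \<theta> i) \<noteq> 0"
      using bound(1)[OF that(1,2)] that(3) by auto
    then show ?thesis
      unfolding bound(3)[OF that(1,2)] F_def times_divide_eq_right
      by (simp add: eq_divide_eq mult.commute)
  qed
  have upper: "f \<le> b * F (\<theta> 1)"
    using bound(1,2)[of 1] diam \<theta>1 unfolding F_def times_divide_eq_right d_def
    by (subst pos_le_divide_eq) (auto simp: mult.commute)
  have lower: "b * F (\<theta> d) \<le> f"
  proof -
    have d: "1 \<le> d"
      using diam(2) by (simp add: d_def)
    have "(K + \<theta> d) * (1 + \<theta> d) < 0"
      using bound(1)[OF d] \<theta>d by (intro mult_pos_neg) auto
    then show ?thesis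
      using bound(2)[OF d] unfolding F_def times_divide_eq_right
      by (simp add: neg_divide_le_eq mult.commute)
  qed
  have not_tight: "\<not> tight_edge R (\<theta> i) x y" if i: "2 \<le> i" "i < d" for i
  proof
    assume tight: "tight_edge R (\<theta> i) x y"
    have i': "1 \<le> i" "i \<le> d"
      using i by auto
    consider "\<theta> i = - 1" | "- 1 < \<theta> i" | "\<theta> i < - 1"
      by linarith
    then show False
    proof cases
      case 1
      then have "b * b = 0"
        using bound(3)[OF i'] tight by (simp add: K)
      then show False
        using b by simp
    next
      case 2
      then have "F (\<theta> 1) < F (\<theta> i)"
        unfolding F_def using \<alpha> b K bound(1)[OF i'] less[of 1 i] i
        by (intro tightness_ratio_strict_antimono) auto
      then show False
        using tight tight_iff[OF i'] 2 upper b by (simp add: mult_less_cancel_left_pos leD)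
    next
      case 3
      then have "F (\<theta> i) < F (\<theta> d)"
        unfolding F_def using \<alpha> b K bound(1)[of d] less[of i d] i
        by (intro tightness_ratio_strict_antimono) auto
      then show False
        using tight tight_iff[OF i'] 3 lower b by simp
    qed
  qed
  show ?thesis
    using tight_iff[of 1] tight_iff[of d] \<theta>1 \<theta>d diam not_tight assms(2)
    unfolding F_def K_def \<alpha>_def b_def f_def d_def by auto
qed

end
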